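(* Let $r\ge3$ be an integer, let $w>0$ be real, set $q=r-1$, and for each $n\in\mathbb N$ let $\mathsf G_n$ be a random graph with distribution $\mathbb P_{n,r}$ (with weight $w$). For every $n\in\mathbb N$ and every integer $k$ with $1\le k<q$, $$\mathbb P\bigl(\chi(\mathsf G_n)\le k\bigr)\le\exp\left(-\frac{(q-k)\ln2}{2kq}n^2+n\ln k+\frac{q\ln2}{8}\right).$$ Consequently, for every integer $k$ with $1\le k<q$ there are constants $c=c(r,k)>0$ and $N=N(r,k)\in\mathbb N$ (not depending on $w$) such that $$\mathbb P\bigl(\chi(\mathsf G_n)\le k\bigr)\le e^{-cn^2}\qquad\text{for every }n\ge N.$$ In particular, when $r\ge4$, the probability that $\mathsf G_n$ is $(r-2)$-partite tends to zero exponentially in $n^2$, i.e. it is at most $e^{-cn^2}$ for some $c>0$ and all sufficiently large $n$.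
   Context: $[n]=\{1,\dots,n\}$, and $\mathbf G_n$ is the set of all simple graphs with vertex set $[n]$. $\chi(G)$ is the chromatic number of $G$, and $K_r(G)$ denotes the number of (unordered) copies of the complete graph $K_r$ in $G$. For $G\in\mathbf G_n$ let $N_r(G)=n^r-r!\,K_r(G)$. The probability measure $\mathbb P_{n,r}$ on $\mathbf G_n$ with weight $w$ is $$\mathbb P_{n,r}(G)=\frac{\exp(w\,N_r(G))}{\sum_{J\in\mathbf G_n}\exp(w\,N_r(J))}=\frac{\exp(-r!\,w\,K_r(G))}{\sum_{J\in\mathbf G_n}\exp(-r!\,w\,K_r(J))}.$$ *)

theory Defs
  imports "HOL-Probability.Probability" "Graph_Theory.Graph_Theory"
begin

text \<open>
  Graph_Theory models a simple graph as a finite, loop-free, symmetric digraph without parallel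
  arcs (locale \<^locale>\<open>pair_graph\<close>); the undirected edge \<open>{u,v}\<close> is the pair of arcs
  \<open>(u,v)\<close> and \<open>(v,u)\<close>.
\<close>

definition graphs :: "nat \<Rightarrow> nat pair_pre_digraph set" where
  "graphs n = {G. pair_graph G \<and> pverts G = {1..n}}"

definition proper_colouring :: "'a pair_pre_digraph \<Rightarrow> nat \<Rightarrow> ('a \<Rightarrow> nat) \<Rightarrow> bool" where
  "proper_colouring G k f \<longleftrightarrow>
     f ` pverts G \<subseteq> {..<k} \<and> (\<forall>(u, v) \<in> parcs G. f u \<noteq> f v)"

definition chromatic_number :: "'a pair_pre_digraph \<Rightarrow> nat" where
  "chromatic_number G = (LEAST k. \<exists>f. proper_colouring G k f)"

text \<open>The classes of a partition witnessing \<open>k\<close>-partiteness may be empty.\<close>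

definition partite :: "nat \<Rightarrow> 'a pair_pre_digraph \<Rightarrow> bool" where
  "partite k G \<longleftrightarrow>
     (\<exists>P :: nat \<Rightarrow> 'a set. (\<Union>i<k. P i) = pverts G \<and> disjoint_family_on P {..<k} \<and>
        (\<forall>i<k. parcs G \<inter> P i \<times> P i = {}))"

definition clique_count :: "nat \<Rightarrow> 'a pair_pre_digraph \<Rightarrow> nat" where
  "clique_count r G =
     card {H :: 'a pair_pre_digraph. subgraph (with_proj H) (with_proj G) \<and>
       complete_digraph r (with_proj H)}"

definition N_count :: "nat \<Rightarrow> nat \<Rightarrow> nat pair_pre_digraph \<Rightarrow> real" where
  "N_count n r G = real n ^ r - fact r * real (clique_count r G)"

definition random_graph_measure :: "nat \<Rightarrow> nat \<Rightarrow> real \<Rightarrow> nat pair_pre_digraph measure" where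
  "random_graph_measure n r w =
     point_measure (graphs n)
       (\<lambda>G. ennreal (exp (w * N_count n r G) / (\<Sum>J\<in>graphs n. exp (w * N_count n r J))))"

lemma clique_count_alt:
  assumes "pair_graph G"
  shows "clique_count r G =
    card {S. S \<subseteq> pverts G \<and> card S = r \<and> (\<forall>u\<in>S. \<forall>v\<in>S. u \<noteq> v \<longrightarrow> (u, v) \<in> parcs G)}"
    (is "_ = card ?C")
proof -
  interpret pair_graph G by (rule assms)
  let ?D = "{H. subgraph (with_proj H) (with_proj G) \<and> complete_digraph r (with_proj H)}"
  have "bij_betw pverts ?D ?C"
  proof (rule bij_betw_byWitness[where
        f' = "\<lambda>S. \<lparr>pverts = S, parcs = {(u,v). (u,v) \<in> S \<times> S \<and> u \<noteq> v}\<rparr>"])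
    show "\<forall>H\<in>?D. \<lparr>pverts = pverts H, parcs = {(u,v). (u,v) \<in> pverts H \<times> pverts H \<and> u \<noteq> v}\<rparr> = H"
      unfolding complete_digraph_pair_def by (metis (mono_tags, lifting) mem_Collect_eq old.unit.exhaust pair_pre_digraph.surjective)
    show "pverts ` ?D \<subseteq> ?C"
      unfolding complete_digraph_pair_def by (auto simp: subgraph_def)
    show "(\<lambda>S. \<lparr>pverts = S, parcs = {(u,v). (u,v) \<in> S \<times> S \<and> u \<noteq> v}\<rparr>) ` ?C \<subseteq> ?D"
      unfolding complete_digraph_pair_def
      by (auto simp: subgraph_def compatible_def wf_digraph_def wf_digraph finite_subset[OF _ pair_finite_verts]
          intro: in_arcsD1 in_arcsD2)
  qed auto
  then show ?thesis unfolding clique_count_def by (rule bij_betw_same_card)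
qed

lemma finite_graphs: "finite (graphs n)"
proof (rule finite_subset)
  show "graphs n \<subseteq> (\<lambda>E. \<lparr>pverts = {1..n}, parcs = E\<rparr>) ` Pow ({1..n} \<times> {1..n})"
  proof
    fix G assume "G \<in> graphs n"
    then have G: "pair_graph G" "pverts G = {1..n}" by (auto simp: graphs_def)
    interpret pair_graph G by (rule G)
    have "parcs G \<subseteq> {1..n} \<times> {1..n}" using wellformed' G(2) by auto
    moreover have "G = \<lparr>pverts = {1..n}, parcs = parcs G\<rparr>" using G(2) by (cases G) auto
    ultimately show "G \<in> (\<lambda>E. \<lparr>pverts = {1..n}, parcs = E\<rparr>) ` Pow ({1..n} \<times> {1..n})" by blast
  qed
qed auto

lemma graphs_nonempty: "graphs n \<noteq> {}"
proof -
  have "\<lparr>pverts = {1..n}, parcs = {}\<rparr> \<in> graphs n"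
    by (auto simp: graphs_def symmetric_def sym_def intro!: pair_graph.intro pair_digraph.intro
        pair_pseudo_graph.intro pair_fin_digraph.intro pair_loopfree_digraph.intro
        pair_sym_digraph.intro pair_wf_digraph.intro pair_fin_digraph_axioms.intro
        pair_loopfree_digraph_axioms.intro pair_sym_digraph_axioms.intro)
  then show ?thesis by blast
qed

lemma prob_space_random_graph_measure: "prob_space (random_graph_measure n r w)"
proof
  let ?e = "\<lambda>G. exp (w * N_count n r G)"
  have pos: "(\<Sum>J\<in>graphs n. ?e J) > 0"
    by (intro sum_pos finite_graphs graphs_nonempty) auto
  have "emeasure (random_graph_measure n r w) (space (random_graph_measure n r w)) =
      (\<Sum>G\<in>graphs n. ennreal (?e G / (\<Sum>J\<in>graphs n. ?e J)))"
    unfolding random_graph_measure_def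
    by (simp add: space_point_measure emeasure_point_measure_finite finite_graphs)
  also have "\<dots> = ennreal (\<Sum>G\<in>graphs n. ?e G / (\<Sum>J\<in>graphs n. ?e J))"
    using pos by (intro sum_ennreal) (auto intro!: divide_nonneg_nonneg)
  also have "\<dots> = 1" using pos by (simp flip: sum_divide_distrib)
  finally show "emeasure (random_graph_measure n r w) (space (random_graph_measure n r w)) = 1" .
qed

text \<open>The second form of the weights: the factor \<open>exp (w * n ^ r)\<close> cancels.\<close>

lemma random_graph_measure_alt:
  "random_graph_measure n r w =
     point_measure (graphs n)
       (\<lambda>G. ennreal (exp (- (fact r * w * real (clique_count r G))) /
          (\<Sum>J\<in>graphs n. exp (- (fact r * w * real (clique_count r J))))))"
proof -
  let ?x = "\<lambda>G. exp (- (fact r * w * real (clique_count r G)))"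
  have *: "exp (w * N_count n r G) = exp (w * real n ^ r) * ?x G" for G
    unfolding N_count_def exp_add[symmetric] by (simp add: algebra_simps)
  show ?thesis
    unfolding random_graph_measure_def * sum_distrib_left[symmetric] by simp
qed

end

theory Submission
  imports Defs
begin

text \<open>
  A \<open>q\<close>-colourable graph contains no \<open>K\<^sub>r\<close>, so all such graphs have the same, maximal, weight, and
  the probability is at most the ratio of two counts. There are at most
  \<open>k\<^sup>n * 2 powr ((1 - 1/k) * n\<^sup>2 / 2)\<close> graphs of chromatic number at most \<open>k\<close>, while the subgraphs
  of the \<open>q\<close>-partite Turan graph alone give \<open>2 powr ((1 - 1/q) * n\<^sup>2 / 2 - q/8)\<close> graphs without
  \<open>K\<^sub>r\<close>.
\<close>

section \<open>Counting the pairs separated by a colouring\<close>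

text \<open>Orienting each pair upwards makes it count once; these are the possible edges of a graph
  on \<open>V\<close> properly coloured by \<open>f\<close>.\<close>

definition bichromatic_pairs :: "('a::linorder) set \<Rightarrow> ('a \<Rightarrow> nat) \<Rightarrow> ('a \<times> 'a) set" where
  "bichromatic_pairs V f = {(u, v). u \<in> V \<and> v \<in> V \<and> u < v \<and> f u \<noteq> f v}"

lemma finite_bichromatic_pairs: "finite V \<Longrightarrow> finite (bichromatic_pairs V f)"
  by (rule finite_subset[of _ "V \<times> V"]) (auto simp: bichromatic_pairs_def)

text \<open>The square \<open>V \<times> V\<close> splits into the bichromatic pairs, their
  reverses, and the squares of the colour classes, which contain the diagonal.\<close>

lemma card_bichromatic_pairs:
  assumes "finite V" "f ` V \<subseteq> {..<k}"
  shows "2 * card (bichromatic_pairs V f) + (\<Sum>i<k. (card {u\<in>V. f u = i})\<^sup>2) = (card V)\<^sup>2"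
proof -
  let ?D = "bichromatic_pairs V f" and ?M = "\<Union>i<k. {u\<in>V. f u = i} \<times> {u\<in>V. f u = i}"
  have fin: "finite ?D" "finite (?D\<inverse>)" "finite ?M"
    using assms finite_bichromatic_pairs by auto
  have "f u < k" if "u \<in> V" for u using that assms(2) by auto
  then have "V \<times> V = ?D \<union> ?D\<inverse> \<union> ?M"
    by (auto simp: bichromatic_pairs_def not_less order_le_less)
  then have "card (V \<times> V) = card (?D \<union> ?D\<inverse> \<union> ?M)" by simp
  also have "\<dots> = card (?D \<union> ?D\<inverse>) + card ?M"
    by (rule card_Un_disjoint) (use fin in \<open>auto simp: bichromatic_pairs_def\<close>)
  also have "card (?D \<union> ?D\<inverse>) = card ?D + card (?D\<inverse>)"
    by (rule card_Un_disjoint) (use fin in \<open>auto simp: bichromatic_pairs_def\<close>)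
  also have "card ?M = (\<Sum>i<k. card ({u\<in>V. f u = i} \<times> {u\<in>V. f u = i}))"
    by (rule card_UN_disjoint) (use assms in auto)
  finally show ?thesis
    by (simp add: card_cartesian_product power2_eq_square)
qed

lemma sum_card_colour_classes:
  fixes f :: "'a \<Rightarrow> nat"
  assumes "finite V" "f ` V \<subseteq> {..<k}"
  shows "(\<Sum>i<k. card {u\<in>V. f u = i}) = card V"
proof -
  have "card (\<Union>i<k. {u\<in>V. f u = i}) = (\<Sum>i<k. card {u\<in>V. f u = i})"
    by (rule card_UN_disjoint) (use assms(1) in auto)
  moreover have "(\<Union>i<k. {u\<in>V. f u = i}) = V" using assms(2) by auto
  ultimately show ?thesis by simp
qed

text \<open>By Cauchy-Schwarz against the all-ones vector, the squares of the class sizes sum to at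
  least \<open>(card V)\<^sup>2 / k\<close>, which bounds the rest of \<open>V \<times> V\<close>
  from above.\<close>

lemma card_bichromatic_pairs_le:
  assumes "finite V" "f ` V \<subseteq> {..<k}" "k \<ge> 1"
  shows "real (card (bichromatic_pairs V f)) \<le> (1 - 1 / real k) * (real (card V))\<^sup>2 / 2"
proof -
  let ?a = "\<lambda>i. real (card {u\<in>V. f u = i})"
  have "(real (card V))\<^sup>2 = (\<Sum>i<k. ?a i * 1)\<^sup>2"
    using sum_card_colour_classes[OF assms(1,2)] by (simp flip: of_nat_sum)
  also have "\<dots> \<le> (\<Sum>i<k. (?a i)\<^sup>2) * (\<Sum>i<k. 1\<^sup>2)"
    by (rule Cauchy_Schwarz_ineq_sum)
  finally have 1: "(real (card V))\<^sup>2 / k \<le> (\<Sum>i<k. (?a i)\<^sup>2)"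
    using assms(3) by (simp add: divide_simps mult.commute)
  have "2 * real (card (bichromatic_pairs V f)) + (\<Sum>i<k. (?a i)\<^sup>2) = (real (card V))\<^sup>2"
    using arg_cong[OF card_bichromatic_pairs[OF assms(1,2)], of real] by simp
  with 1 show ?thesis by (simp add: algebra_simps)
qed

text \<open>
  For integers \<open>a\<^sub>i \<in> {m, m + 1}\<close> with sum \<open>n\<close>, summing \<open>(a\<^sub>i - m) * (a\<^sub>i - m - 1) = 0\<close> gives
  \<open>\<Sum>a\<^sub>i\<^sup>2 = (2m + 1) n - q m (m + 1) = n\<^sup>2 / q + q / 4 - (n - q (m + 1/2))\<^sup>2 / q\<close>.
\<close>

lemma card_bichromatic_pairs_ge:
  assumes "finite V" "f ` V \<subseteq> {..<q}" "q \<ge> 1"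
    and bal: "\<And>i. i < q \<Longrightarrow> card {u\<in>V. f u = i} \<in> {m, m + 1}"
  shows "real (card (bichromatic_pairs V f)) \<ge> (1 - 1 / real q) * (real (card V))\<^sup>2 / 2 - real q / 8"
proof -
  let ?a = "\<lambda>i. real (card {u\<in>V. f u = i})" and ?n = "real (card V)"
  have n: "(\<Sum>i<q. ?a i) = ?n"
    using sum_card_colour_classes[OF assms(1,2)] by (simp flip: of_nat_sum)
  have "(?a i)\<^sup>2 = (2 * m + 1) * ?a i - real m * (m + 1)" if "i < q" for i
    using bal[OF that] by (auto simp: power2_eq_square algebra_simps)
  then have "(\<Sum>i<q. (?a i)\<^sup>2) = (\<Sum>i<q. (2 * m + 1) * ?a i - real m * (m + 1))"
    by (intro sum.cong) auto
  also have "\<dots> = (2 * m + 1) * ?n - q * (real m * (m + 1))"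
    by (simp only: sum_subtractf sum_distrib_left[symmetric] n) simp
  also have "\<dots> = ?n\<^sup>2 / q + q / 4 - (?n - q * (m + 1 / 2))\<^sup>2 / q"
    using assms(3) by (simp add: field_simps power2_eq_square)
  also have "\<dots> \<le> ?n\<^sup>2 / q + q / 4" by simp
  finally have 1: "(\<Sum>i<q. (?a i)\<^sup>2) \<le> ?n\<^sup>2 / q + q / 4" .
  have "2 * real (card (bichromatic_pairs V f)) + (\<Sum>i<q. (?a i)\<^sup>2) = ?n\<^sup>2"
    using arg_cong[OF card_bichromatic_pairs[OF assms(1,2)], of real] by simp
  with 1 show ?thesis by (simp add: algebra_simps)
qed

section \<open>Balance of the residue classes\<close>

text \<open>The right-hand side is the ceiling of \<open>(n - i) / q\<close>. In the induction the
  new vertex \<open>Suc n\<close> joins the class \<open>n mod q\<close>, and the quotient must grow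
  by one in exactly that case.\<close>

lemma card_residue_class:
  assumes "i < q"
  shows "card {u\<in>{1..n}. (u - 1) mod q = i} = (n + q - 1 - i) div q"
proof (induction n)
  case 0
  then show ?case using assms by simp
next
  case (Suc n)
  have "{u\<in>{1..Suc n}. (u - 1) mod q = i} =
      {u\<in>{1..n}. (u - 1) mod q = i} \<union> (if n mod q = i then {Suc n} else {})"
    by (auto simp: le_Suc_eq)
  then have 1: "card {u\<in>{1..Suc n}. (u - 1) mod q = i} =
      (n + q - 1 - i) div q + (if n mod q = i then 1 else 0)"
    using Suc by (auto simp: card_insert_if)
  have "Suc n + q - 1 - i = Suc (n + q - 1 - i)" using assms by simp
  \<comment> \<open>A quotient by \<open>q\<close> grows at a successor exactly when
    \<open>q\<close> divides that successor, here \<open>n + q - i\<close>.\<close>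
  moreover have "Suc (n + q - 1 - i) mod q = 0 \<longleftrightarrow> n mod q = i"
  proof -
    have "Suc (n + q - 1 - i) = n + q - i" using assms by simp
    then have "Suc (n + q - 1 - i) mod q = 0 \<longleftrightarrow> (n + q - i) mod q = 0" by simp
    also have "\<dots> \<longleftrightarrow> q dvd (n + q) - i" by auto
    also have "\<dots> \<longleftrightarrow> (n + q) mod q = i mod q"
      using assms mod_eq_dvd_iff_nat[of i "n + q" q] by auto
    finally show ?thesis using assms by simp
  qed
  ultimately show ?case using 1 by (simp add: div_Suc)
qed

text \<open>The numerator \<open>n + q - 1 - i\<close> lies between \<open>n\<close> and
  \<open>n + q\<close>. This supplies the balance hypothesis of
  \<open>card_bichromatic_pairs_ge\<close> with \<open>m = n div q\<close>.\<close>

lemma card_residue_class_cases: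
  assumes "i < q"
  shows "card {u\<in>{1..n}. (u - 1) mod q = i} \<in> {n div q, n div q + 1}"
proof -
  have "n div q \<le> (n + q - 1 - i) div q" by (rule div_le_mono) (use assms in simp)
  moreover have "(n + q - 1 - i) div q \<le> (n + q) div q" by (rule div_le_mono) simp
  moreover have "(n + q) div q = n div q + 1" using assms by simp
  ultimately show ?thesis unfolding card_residue_class[OF assms] by auto
qed

section \<open>Graphs with a prescribed proper colouring\<close>

text \<open>This turns the locale into conditions easily checked for explicit arc sets. Each arc is
  its own pair of ends, so parallel arcs cannot occur.\<close>

lemma pair_graph_iff:
  "pair_graph G \<longleftrightarrow> finite (pverts G) \<and> parcs G \<subseteq> pverts G \<times> pverts G \<and> sym (parcs G) \<and> irrefl (parcs G)"
proof
  assume "pair_graph G"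
  then interpret pair_graph G .
  show "finite (pverts G) \<and> parcs G \<subseteq> pverts G \<times> pverts G \<and> sym (parcs G) \<and> irrefl (parcs G)"
    using pair_finite_verts wellformed' no_loops' sym_arcs
    by (auto simp: irrefl_def symmetric_def) metis
next
  assume *: "finite (pverts G) \<and> parcs G \<subseteq> pverts G \<times> pverts G \<and> sym (parcs G) \<and> irrefl (parcs G)"
  then have "finite (parcs G)" using finite_subset by blast
  moreover have "arc_to_ends (with_proj G) = (\<lambda>e. e)" by (auto simp: arc_to_ends_def)
  ultimately show "pair_graph G" using *
    by unfold_locales (auto simp: symmetric_def arcs_ends_def irrefl_def)
qed

text \<open>A graph is determined by its upward arcs, and symmetric closure recovers it. Properness
  of \<open>f\<close> says that these arcs are bichromatic, so every subset of the bichromatic pairs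
  occurs exactly once.\<close>

lemma card_properly_coloured_graphs:
  assumes f: "f ` {1..n} \<subseteq> {..<k}"
  shows "card {G \<in> graphs n. proper_colouring G k f} = 2 ^ card (bichromatic_pairs {1..n} f)"
proof -
  let ?D = "bichromatic_pairs {1..n} f"
  have "bij_betw (\<lambda>G. parcs G \<inter> {(u, v). u < v}) {G \<in> graphs n. proper_colouring G k f} (Pow ?D)"
  proof (rule bij_betw_byWitness[where f' = "\<lambda>E. \<lparr>pverts = {1..n}, parcs = E \<union> E\<inverse>\<rparr>"])
    show "\<forall>G\<in>{G \<in> graphs n. proper_colouring G k f}.
        \<lparr>pverts = {1..n}, parcs = parcs G \<inter> {(u, v). u < v} \<union> (parcs G \<inter> {(u, v). u < v})\<inverse>\<rparr> = G"
    proof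
      fix G assume "G \<in> {G \<in> graphs n. proper_colouring G k f}"
      then have G: "pverts G = {1..n}" "sym (parcs G)" "irrefl (parcs G)"
        by (auto simp: graphs_def pair_graph_iff)
      then have "parcs G \<inter> {(u, v). u < v} \<union> (parcs G \<inter> {(u, v). u < v})\<inverse> = parcs G"
        by (auto simp: sym_def irrefl_def not_less order_le_less)
      then show "\<lparr>pverts = {1..n},
          parcs = parcs G \<inter> {(u, v). u < v} \<union> (parcs G \<inter> {(u, v). u < v})\<inverse>\<rparr> = G"
        using G(1) by (cases G) auto
    qed
    show "\<forall>E\<in>Pow ?D. parcs \<lparr>pverts = {1..n}, parcs = E \<union> E\<inverse>\<rparr> \<inter> {(u, v). u < v} = E"
      by (auto simp: bichromatic_pairs_def)
    show "(\<lambda>G. parcs G \<inter> {(u, v). u < v}) ` {G \<in> graphs n. proper_colouring G k f} \<subseteq> Pow ?D"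
      by (auto simp: graphs_def pair_graph_iff proper_colouring_def bichromatic_pairs_def)
    show "(\<lambda>E. \<lparr>pverts = {1..n}, parcs = E \<union> E\<inverse>\<rparr>) ` Pow ?D
        \<subseteq> {G \<in> graphs n. proper_colouring G k f}"
    proof (rule image_subsetI)
      fix E assume "E \<in> Pow ?D"
      then have "u \<in> {1..n} \<and> v \<in> {1..n} \<and> u < v \<and> f u \<noteq> f v" if "(u, v) \<in> E" for u v
        using that by (auto simp: bichromatic_pairs_def)
      then show "\<lparr>pverts = {1..n}, parcs = E \<union> E\<inverse>\<rparr> \<in> {G \<in> graphs n. proper_colouring G k f}"
        using f by (fastforce simp: graphs_def pair_graph_iff proper_colouring_def irrefl_def sym_def)
    qed
  qed
  then show ?thesis
    by (simp add: bij_betw_same_card card_Pow finite_bichromatic_pairs)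
qed

section \<open>Chromatic number and partitions\<close>

lemma chromatic_number_le_iff:
  assumes "G \<in> graphs n"
  shows "chromatic_number G \<le> k \<longleftrightarrow> (\<exists>f. proper_colouring G k f)"
proof
  \<comment> \<open>Some colouring must exist for \<open>LEAST\<close> to be attained. The identity
    is one; the vertex \<open>n\<close> forces \<open>Suc n\<close> colours, as these start at
    0.\<close>
  have "proper_colouring G (Suc n) (\<lambda>u. u)"
    using assms by (auto simp: proper_colouring_def graphs_def pair_graph_iff irrefl_def)
  then have "\<exists>f. proper_colouring G (chromatic_number G) f"
    unfolding chromatic_number_def
    by (intro LeastI[where P = "\<lambda>k. \<exists>f. proper_colouring G k f"] exI)
  moreover assume "chromatic_number G \<le> k"
  ultimately show "\<exists>f. proper_colouring G k f"
    unfolding proper_colouring_def by (meson lessThan_subset_iff order_trans)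
next
  assume "\<exists>f. proper_colouring G k f"
  then show "chromatic_number G \<le> k" unfolding chromatic_number_def by (rule Least_le)
qed

text \<open>Colouring each vertex by the index of a class containing it is proper, since no arc
  stays inside a class.\<close>

lemma partite_imp_chromatic_number_le:
  assumes "G \<in> graphs n" "partite k G"
  shows "chromatic_number G \<le> k"
proof -
  obtain P where P: "(\<Union>i<k. P i) = pverts G" "\<forall>i<k. parcs G \<inter> P i \<times> P i = {}"
    using assms(2) unfolding partite_def by blast
  then have "\<forall>v\<in>pverts G. \<exists>i<k. v \<in> P i" by blast
  then obtain f where f: "\<And>v. v \<in> pverts G \<Longrightarrow> f v < k \<and> v \<in> P (f v)" by metis
  have "f u \<noteq> f v" if "(u, v) \<in> parcs G" for u v
  proof
    assume eq: "f u = f v"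
    have "u \<in> pverts G" "v \<in> pverts G"
      using that assms(1) by (auto simp: graphs_def pair_graph_iff)
    with f eq have "(u, v) \<in> P (f v) \<times> P (f v)" "f v < k" by (metis SigmaI, metis)
    with P(2) that show False by blast
  qed
  then have "proper_colouring G k f" using f by (auto simp: proper_colouring_def)
  then show ?thesis using chromatic_number_le_iff[OF assms(1)] by blast
qed

section \<open>Counting graphs of bounded chromatic number\<close>

text \<open>A union bound over the \<open>k ^ n\<close> colourings of \<open>{1..n}\<close>, each
  proper for at most the stated power of 2 many graphs.\<close>

lemma card_chromatic_number_le:
  assumes "k \<ge> 1"
  shows "real (card {G \<in> graphs n. chromatic_number G \<le> k})
    \<le> real k ^ n * 2 powr ((1 - 1 / real k) * (real n)\<^sup>2 / 2)"
proof -
  let ?F = "{1..n} \<rightarrow>\<^sub>E {..<k}" and ?C = "\<lambda>f. {G \<in> graphs n. proper_colouring G k f}"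
  have "{G \<in> graphs n. chromatic_number G \<le> k} \<subseteq> (\<Union>f\<in>?F. ?C f)"
  proof
    fix G assume G: "G \<in> {G \<in> graphs n. chromatic_number G \<le> k}"
    then obtain f where f: "proper_colouring G k f" using chromatic_number_le_iff by blast
    have V: "pverts G = {1..n}" "parcs G \<subseteq> {1..n} \<times> {1..n}"
      using G by (auto simp: graphs_def pair_graph_iff)
    \<comment> \<open>Colourings are made extensional so that only finitely many are summed
      over.\<close>
    have "restrict f {1..n} \<in> ?F" using f V by (auto simp: proper_colouring_def)
    moreover have "proper_colouring G k (restrict f {1..n})"
      using f V by (fastforce simp: proper_colouring_def)
    ultimately show "G \<in> (\<Union>f\<in>?F. ?C f)" using G by blast
  qed
  then have "card {G \<in> graphs n. chromatic_number G \<le> k} \<le> card (\<Union>f\<in>?F. ?C f)"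
    by (intro card_mono finite_UN_I finite_PiE) (auto simp: finite_graphs)
  also have "\<dots> \<le> (\<Sum>f\<in>?F. card (?C f))"
    by (intro card_UN_le finite_PiE) auto
  finally have "real (card {G \<in> graphs n. chromatic_number G \<le> k}) \<le> (\<Sum>f\<in>?F. real (card (?C f)))"
    by (simp flip: of_nat_sum)
  also have "\<dots> \<le> (\<Sum>f\<in>?F. 2 powr ((1 - 1 / real k) * (real n)\<^sup>2 / 2))"
  proof (rule sum_mono)
    fix f assume "f \<in> ?F"
    then have f: "f ` {1..n} \<subseteq> {..<k}" by auto
    show "real (card (?C f)) \<le> 2 powr ((1 - 1 / real k) * (real n)\<^sup>2 / 2)"
      using card_bichromatic_pairs_le[OF _ f assms]
      by (simp add: card_properly_coloured_graphs[OF f] powr_realpow[symmetric])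
  qed
  also have "\<dots> = real k ^ n * 2 powr ((1 - 1 / real k) * (real n)\<^sup>2 / 2)"
    by (simp add: card_PiE)
  finally show ?thesis .
qed

lemma card_chromatic_number_ge:
  assumes "q \<ge> 1"
  shows "2 powr ((1 - 1 / real q) * (real n)\<^sup>2 / 2 - real q / 8)
    \<le> real (card {G \<in> graphs n. chromatic_number G \<le> q})"
proof -
  \<comment> \<open>This one colouring suffices: its classes are the parts of the Turan graph, whose
    subgraphs are the graphs it colours properly.\<close>
  let ?f = "\<lambda>u. (u - 1) mod q"
  have f: "?f ` {1..n} \<subseteq> {..<q}" using assms by auto
  have "2 powr ((1 - 1 / real q) * (real n)\<^sup>2 / 2 - real q / 8)
      \<le> 2 powr real (card (bichromatic_pairs {1..n} ?f))"
    using card_bichromatic_pairs_ge[OF _ f assms card_residue_class_cases] by simp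
  also have "\<dots> = real (card {G \<in> graphs n. proper_colouring G q ?f})"
    unfolding card_properly_coloured_graphs[OF f] by (simp add: powr_realpow)
  also have "\<dots> \<le> real (card {G \<in> graphs n. chromatic_number G \<le> q})"
    unfolding of_nat_le_iff
    by (intro card_mono) (auto simp: finite_graphs chromatic_number_le_iff)
  finally show ?thesis .
qed

section \<open>Reducing probabilities to counts\<close>

text \<open>A proper colouring is injective on a clique, so cliques have fewer than \<open>r\<close>
  vertices and the clique count vanishes.\<close>

lemma N_count_eq_power:
  assumes "G \<in> graphs n" "chromatic_number G < r"
  shows "N_count n r G = real n ^ r"
proof -
  obtain f where f: "proper_colouring G (chromatic_number G) f"
    using chromatic_number_le_iff[OF assms(1)] by blast
  have G: "pair_graph G" "finite (pverts G)" using assms(1) by (auto simp: graphs_def pair_graph_iff)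
  have "card S < r" if S: "S \<subseteq> pverts G" "\<forall>u\<in>S. \<forall>v\<in>S. u \<noteq> v \<longrightarrow> (u, v) \<in> parcs G" for S
  proof -
    have "f u \<noteq> f v" if "(u, v) \<in> parcs G" for u v
      using f that by (auto simp: proper_colouring_def)
    with S(2) have "inj_on f S" unfolding inj_on_def by blast
    then have "card S = card (f ` S)" by (simp add: card_image)
    also have "\<dots> \<le> card {..<chromatic_number G}"
      by (rule card_mono) (use f S(1) in \<open>auto simp: proper_colouring_def\<close>)
    finally show ?thesis using assms(2) by simp
  qed
  then have "{S. S \<subseteq> pverts G \<and> card S = r \<and> (\<forall>u\<in>S. \<forall>v\<in>S. u \<noteq> v \<longrightarrow> (u, v) \<in> parcs G)} = {}"
    by blast
  then have "clique_count r G = 0" by (simp only: clique_count_alt[OF G(1)] card.empty)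
  then show ?thesis by (simp add: N_count_def)
qed

lemma prob_random_graph_measure:
  "\<P>(G in random_graph_measure n r w. Q G) =
     (\<Sum>G | G \<in> graphs n \<and> Q G. exp (w * N_count n r G)) / (\<Sum>J\<in>graphs n. exp (w * N_count n r J))"
proof -
  have "emeasure (random_graph_measure n r w) {G \<in> graphs n. Q G} =
      (\<Sum>G | G \<in> graphs n \<and> Q G.
        ennreal (exp (w * N_count n r G) / (\<Sum>J\<in>graphs n. exp (w * N_count n r J))))"
    unfolding random_graph_measure_def
    by (subst emeasure_point_measure_finite) (auto simp: finite_graphs)
  also have "\<dots> = ennreal (\<Sum>G | G \<in> graphs n \<and> Q G.
        exp (w * N_count n r G) / (\<Sum>J\<in>graphs n. exp (w * N_count n r J)))"
    by (intro sum_ennreal divide_nonneg_nonneg sum_nonneg) auto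
  finally show ?thesis
    by (simp add: measure_def random_graph_measure_def space_point_measure sum_divide_distrib
        sum_nonneg)
qed

text \<open>All graphs counted here share the weight \<open>?E\<close>. Restricting the normalising
  sum to chromatic number at most \<open>q\<close> bounds it from below, and then \<open>?E\<close>
  cancels together with all dependence on \<open>w\<close>.\<close>

lemma prob_chromatic_number_le_ratio:
  assumes "k \<le> q" "1 \<le> q" "q < r"
  shows "\<P>(G in random_graph_measure n r w. chromatic_number G \<le> k)
    \<le> real (card {G \<in> graphs n. chromatic_number G \<le> k}) /
       real (card {G \<in> graphs n. chromatic_number G \<le> q})"
proof -
  let ?A = "\<lambda>k. {G \<in> graphs n. chromatic_number G \<le> k}" and ?E = "exp (w * real n ^ r)"
  have sum_eq: "(\<Sum>G\<in>?A j. exp (w * N_count n r G)) = real (card (?A j)) * ?E" if "j \<le> q" for j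
    using that assms(3) by (simp add: N_count_eq_power)
  have "real (card (?A q)) * ?E \<le> (\<Sum>J\<in>graphs n. exp (w * N_count n r J))"
    unfolding sum_eq[OF order_refl, symmetric] by (rule sum_mono2) (auto simp: finite_graphs)
  moreover have "0 < real (card (?A q))"
    by (rule less_le_trans[OF _ card_chromatic_number_ge[OF assms(2)]]) simp
  ultimately have "\<P>(G in random_graph_measure n r w. chromatic_number G \<le> k)
      \<le> (real (card (?A k)) * ?E) / (real (card (?A q)) * ?E)"
    unfolding prob_random_graph_measure sum_eq[OF assms(1)]
    by (intro divide_left_mono mult_nonneg_nonneg mult_pos_pos) (auto intro: less_le_trans[rotated])
  then show ?thesis by simp
qed

lemma prob_chromatic_number_le:
  assumes "1 \<le> k" "k < q" "q < r"
  shows "\<P>(G in random_graph_measure n r w. chromatic_number G \<le> k)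
    \<le> exp (- ((real q - real k) * ln 2 / (2 * real k * real q)) * (real n)\<^sup>2
            + real n * ln (real k) + real q * ln 2 / 8)"
proof -
  have q: "q \<ge> 1" "k \<le> q" using assms by auto
  let ?u = "(1 - 1 / real k) * (real n)\<^sup>2 / 2" and ?l = "(1 - 1 / real q) * (real n)\<^sup>2 / 2 - real q / 8"
  have "\<P>(G in random_graph_measure n r w. chromatic_number G \<le> k)
      \<le> real (card {G \<in> graphs n. chromatic_number G \<le> k}) /
         real (card {G \<in> graphs n. chromatic_number G \<le> q})"
    by (rule prob_chromatic_number_le_ratio[OF q(2,1) assms(3)])
  also have "\<dots> \<le> (real k ^ n * 2 powr ?u) / 2 powr ?l"
    using card_chromatic_number_le[OF assms(1)] card_chromatic_number_ge[OF q(1)]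
    by (intro frac_le) auto
  also have "\<dots> = exp (real n * ln (real k)) * exp (?u * ln 2) / exp (?l * ln 2)"
    using assms(1) by (simp add: powr_def exp_of_nat_mult)
  also have "\<dots> = exp (real n * ln (real k) + ?u * ln 2 - ?l * ln 2)"
    by (simp add: exp_add exp_diff)
  \<comment> \<open>The quadratic terms combine through
    \<open>(1 - 1/k) - (1 - 1/q) = (q - k) / (k * q)\<close>.\<close>
  also have "real n * ln (real k) + ?u * ln 2 - ?l * ln 2 =
      - ((real q - real k) * ln 2 / (2 * real k * real q)) * (real n)\<^sup>2
            + real n * ln (real k) + real q * ln 2 / 8"
    using assms(1,2) by (simp add: field_simps)
  finally show ?thesis .
qed

section \<open>Exponential decay and conclusion\<close>

lemma prob_chromatic_number_le_exponential:
  assumes "1 \<le> k" "k < q" "q < r"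
  shows "\<exists>c::real. c > 0 \<and> (\<exists>N::nat. \<forall>w::real. w > 0 \<longrightarrow> (\<forall>n\<ge>N.
    \<P>(G in random_graph_measure n r w. chromatic_number G \<le> k) \<le> exp (- c * (real n)\<^sup>2)))"
proof -
  define a where "a = (real q - real k) * ln 2 / (2 * real k * real q)"
  \<comment> \<open>For \<open>n \<ge> 1\<close> the lower-order terms of the exponent are at most
    \<open>b * n\<close>.\<close>
  define b where "b = ln (real k) + real q * ln 2 / 8"
  have a: "a > 0" using assms by (simp add: a_def)
  \<comment> \<open>From this \<open>N\<close> on, \<open>b * n\<close> consumes at most half of the
    quadratic term \<open>a * n\<^sup>2\<close>, which leaves \<open>c = a / 2\<close>. Neither
    constant involves \<open>w\<close>.\<close>
  obtain N where N: "real N \<ge> max 1 (2 * b / a)" using real_arch_simple by blast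
  have "\<P>(G in random_graph_measure n r w. chromatic_number G \<le> k) \<le> exp (- (a / 2) * (real n)\<^sup>2)"
    if "n \<ge> N" for n w
  proof -
    have n: "real n \<ge> 1" "real n \<ge> 2 * b / a" using N that by linarith+
    have "real q * ln 2 / 8 \<le> real n * (real q * ln 2 / 8)"
      using mult_right_mono[OF n(1), of "real q * ln 2 / 8"] by simp
    then have "real n * ln (real k) + real q * ln 2 / 8 \<le> real n * b"
      by (simp add: b_def algebra_simps)
    also have "b \<le> a / 2 * real n" using n(2) a by (simp add: field_simps)
    then have "real n * b \<le> real n * (a / 2 * real n)" by (rule mult_left_mono) simp
    finally have "real n * ln (real k) + real q * ln 2 / 8 \<le> a / 2 * (real n)\<^sup>2"
      by (simp add: power2_eq_square algebra_simps)
    then have "- a * (real n)\<^sup>2 + real n * ln (real k) + real q * ln 2 / 8 \<le> - (a / 2) * (real n)\<^sup>2"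
      by (simp add: field_simps)
    then show ?thesis
      using order_trans[OF prob_chromatic_number_le[OF assms, of n w], folded a_def] by simp
  qed
  then show ?thesis using a by (intro exI[of _ "a / 2"]) auto
qed

lemma prob_partite_le:
  "\<P>(G in random_graph_measure n r w. partite k G)
    \<le> \<P>(G in random_graph_measure n r w. chromatic_number G \<le> k)"
  unfolding prob_random_graph_measure
  by (intro divide_right_mono sum_mono2 sum_nonneg)
    (auto simp: finite_graphs partite_imp_chromatic_number_le)

theorem corollary6p6:
  fixes r q :: nat
  assumes "r \<ge> 3" and "q = r - 1"
  shows "(\<forall>w::real. w > 0 \<longrightarrow> (\<forall>n k :: nat. 1 \<le> k \<and> k < q \<longrightarrow>
            \<P>(G in random_graph_measure n r w. chromatic_number G \<le> k)
              \<le> exp (- ((real q - real k) * ln 2 / (2 * real k * real q)) * (real n)\<^sup>2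
                      + real n * ln (real k) + real q * ln 2 / 8))) \<and>
         (\<forall>k::nat. 1 \<le> k \<and> k < q \<longrightarrow>
            (\<exists>c::real. c > 0 \<and> (\<exists>N::nat. \<forall>w::real. w > 0 \<longrightarrow> (\<forall>n\<ge>N.
               \<P>(G in random_graph_measure n r w. chromatic_number G \<le> k)
                 \<le> exp (- c * (real n)\<^sup>2))))) \<and>
         (r \<ge> 4 \<longrightarrow>
            (\<exists>c::real. c > 0 \<and> (\<exists>N::nat. \<forall>w::real. w > 0 \<longrightarrow> (\<forall>n\<ge>N.
               \<P>(G in random_graph_measure n r w. partite (r - 2) G)
                 \<le> exp (- c * (real n)\<^sup>2)))))"
proof (intro conjI allI impI)
  have q: "q < r" using assms by simp
  show "\<P>(G in random_graph_measure n r w. chromatic_number G \<le> k)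
      \<le> exp (- ((real q - real k) * ln 2 / (2 * real k * real q)) * (real n)\<^sup>2
              + real n * ln (real k) + real q * ln 2 / 8)" if "1 \<le> k \<and> k < q" for w n k
    using that prob_chromatic_number_le q by blast
  show exponential: "\<exists>c::real. c > 0 \<and> (\<exists>N::nat. \<forall>w::real. w > 0 \<longrightarrow> (\<forall>n\<ge>N.
      \<P>(G in random_graph_measure n r w. chromatic_number G \<le> k) \<le> exp (- c * (real n)\<^sup>2)))"
    if "1 \<le> k \<and> k < q" for k
    using that prob_chromatic_number_le_exponential q by blast
  assume "r \<ge> 4"
  then have "1 \<le> r - 2 \<and> r - 2 < q" using assms(2) by auto
  from exponential[OF this]
  \<comment> \<open>The same \<open>c\<close> and \<open>N\<close> serve, because being partite
    implies the chromatic bound.\<close>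
  show "\<exists>c::real. c > 0 \<and> (\<exists>N::nat. \<forall>w::real. w > 0 \<longrightarrow> (\<forall>n\<ge>N.
      \<P>(G in random_graph_measure n r w. partite (r - 2) G) \<le> exp (- c * (real n)\<^sup>2)))"
    by (elim ex_forward conj_forward all_forward imp_forward)
      (blast intro: order_trans[OF prob_partite_le])+
qed

end
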